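(* Let $U=(u_n)_{n\ge0}$ be a Pisot numeration associated to $\beta$. If $\beta$ satisfies Condition F, then $U$ preserves zeros.
   Context: A Pisot number is a real algebraic integer $\beta>1$ all of whose other Galois conjugates have modulus strictly less than $1$. Let $P(X)=X^d-a_{d-1}X^{d-1}-\cdots-a_1X-a_0\in\mathbb{Z}[X]$ be its minimal polynomial. A Pisot numeration of degree $d$ associated to $\beta$ is a sequence $U=(u_n)_{n\ge0}$ of strictly positive integers with $u_0=1$, given by integer initial conditions $u_0=1,u_{-1},\dots,u_{-d+1}$ and the recurrence $u_n=a_{d-1}u_{n-1}+\cdots+a_0u_{n-d}$ for all $n\ge1$. Finite sequences of integers $g=g_k\cdots g_0\in\mathbb{Z}^*$ are identified with sequences $(g_n)_{n\ge0}$ with $g_n=0$ for $n>k$; $[g]_U=\sum_i g_iu_i$. For $n\in\mathbb{N}$, $(n)_U$ is the normalised (greedy) expansion of $n$: the lexicographically greatest finite sequence $(d_i)_{i\ge 0}$ of non-negative integers with $\sum_i d_iu_i=n$, characterised by $\sum_{i=0}^{\ell}d_iu_i<u_{\ell+1}$ for each $\ell\ge0$. $\operatorname{ord}(g)=\inf\{n:g_n\ne0\}$ ($=\infty$ for the zero sequence), $\|g\|_\infty=\sup_n|g_n|$, $\nu_U(n)=\operatorname{ord}((|n|)_U)$ for $n\in\mathbb{Z}$, and $\nu_U(g)=\nu_U([g]_U)$ for finite $g$. $U$ preserves zeros if for each natural number $c$ there is a constant $K_c$ such that $\nu_U(g)\ge\operatorname{ord}(g)-K_c$ for each $g\in\mathbb{Z}^*$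 with $\|g\|_\infty\le c$. The (normalised, greedy) $\beta$-expansion of a real $x\ge0$ is the unique sequence of non-negative integers $(d_i)_{i\le n}$ with $x=\sum_{i\le n}d_i\beta^i$ and $\sum_{i\le k}d_i\beta^i<\beta^{k+1}$ for each $k\le n$ (leading zeros being disregarded). $\operatorname{Fin}(\beta)$ is the set of $x\ge0$ whose $\beta$-expansion is finite (has finitely many non-zero digits). $\beta$ satisfies Condition F if every non-negative element of $\mathbb{Z}[\beta]$ belongs to $\operatorname{Fin}(\beta)$. *)

theory Defs
  imports
    "HOL-Analysis.Infinite_Sum"
    "HOL-Library.Extended_Nat"
    "HOL-Computational_Algebra.Polynomial"
begin

section \<open>Pisot numbers\<close>

definition is_min_poly :: "real \<Rightarrow> int poly \<Rightarrow> bool" where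
  "is_min_poly \<beta> P \<longleftrightarrow>
     lead_coeff P = 1 \<and> irreducible (map_poly of_int P :: rat poly) \<and>
     poly (map_poly of_int P) \<beta> = 0"

definition galois_conjugates :: "real \<Rightarrow> complex set" where
  "galois_conjugates \<beta> = {z. \<exists>P. is_min_poly \<beta> P \<and> poly (map_poly of_int P) z = 0}"

definition pisot_number :: "real \<Rightarrow> bool" where
  "pisot_number \<beta> \<longleftrightarrow>
     algebraic_int \<beta> \<and> \<beta> > 1 \<and>
     (\<forall>z \<in> galois_conjugates \<beta> - {complex_of_real \<beta>}. norm z < 1)"

text \<open>
  Writing the minimal polynomial as $X^d - a_{d-1}X^{d-1} - \cdots - a_0$, we have
  $a_i = -$\<open>coeff P i\<close>. The sequence \<open>v\<close> extends \<open>U\<close> by the initial conditions at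
  indices $-1, \ldots, -d+1$; its values at smaller indices are irrelevant.
\<close>

definition pisot_numeration :: "real \<Rightarrow> (nat \<Rightarrow> int) \<Rightarrow> bool" where
  "pisot_numeration \<beta> U \<longleftrightarrow>
     (\<forall>n. U n > 0) \<and>
     (\<exists>P. is_min_poly \<beta> P \<and>
       (\<exists>v :: int \<Rightarrow> int.
          (\<forall>n. U n = v (int n)) \<and> v 0 = 1 \<and>
          (\<forall>n\<ge>1. v n = (\<Sum>i<degree P. - coeff P i * v (n - int (degree P) + int i)))))"


section \<open>Normalised expansions of integers\<close>

definition finite_seqs :: "(nat \<Rightarrow> 'a::zero) set" where
  "finite_seqs = {g. finite {i. g i \<noteq> 0}}"

definition seq_val :: "(nat \<Rightarrow> int) \<Rightarrow> (nat \<Rightarrow> int) \<Rightarrow> int" where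
  "seq_val U g = (\<Sum>i | g i \<noteq> 0. g i * U i)"

definition represents :: "(nat \<Rightarrow> int) \<Rightarrow> (nat \<Rightarrow> nat) \<Rightarrow> nat \<Rightarrow> bool" where
  "represents U d n \<longleftrightarrow> d \<in> finite_seqs \<and> seq_val U (\<lambda>i. int (d i)) = int n"

text \<open>Digits are compared from the most significant one (the largest index) downwards.\<close>

definition lex_less :: "(nat \<Rightarrow> nat) \<Rightarrow> (nat \<Rightarrow> nat) \<Rightarrow> bool" where
  "lex_less d e \<longleftrightarrow> (\<exists>k. d k < e k \<and> (\<forall>i>k. d i = e i))"

definition is_normalised :: "(nat \<Rightarrow> int) \<Rightarrow> nat \<Rightarrow> (nat \<Rightarrow> nat) \<Rightarrow> bool" where
  "is_normalised U n d \<longleftrightarrow>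
     represents U d n \<and> (\<forall>e. represents U e n \<longrightarrow> e = d \<or> lex_less e d)"

definition normalised :: "(nat \<Rightarrow> int) \<Rightarrow> nat \<Rightarrow> nat \<Rightarrow> nat" where
  "normalised U n = (THE d. is_normalised U n d)"

definition seq_ord :: "(nat \<Rightarrow> 'a::zero) \<Rightarrow> enat" where
  "seq_ord g = (INF n \<in> {n. g n \<noteq> 0}. enat n)"

definition sup_norm :: "(nat \<Rightarrow> int) \<Rightarrow> int" where
  "sup_norm g = (SUP n. \<bar>g n\<bar>)"

definition nu :: "(nat \<Rightarrow> int) \<Rightarrow> int \<Rightarrow> enat" where
  "nu U n = seq_ord (normalised U (nat \<bar>n\<bar>))"

text \<open>
  The inequality $\nu_U(g) \ge \mathrm{ord}(g) - K_c$ is written additively, so that no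
  truncated subtraction occurs.
\<close>

definition preserves_zeros :: "(nat \<Rightarrow> int) \<Rightarrow> bool" where
  "preserves_zeros U \<longleftrightarrow>
     (\<forall>c::nat. \<exists>K::nat. \<forall>g \<in> finite_seqs.
        sup_norm g \<le> int c \<longrightarrow> seq_ord g \<le> nu U (seq_val U g) + enat K)"


section \<open>Expansions of real numbers and Condition F\<close>

text \<open>
  Digits are indexed by all integers; they vanish above some index \<open>n\<close>, and padding
  with leading zeros does not change the digit function.
\<close>

definition is_beta_expansion :: "real \<Rightarrow> real \<Rightarrow> (int \<Rightarrow> nat) \<Rightarrow> bool" where
  "is_beta_expansion \<beta> x d \<longleftrightarrow>
     (\<exists>n. (\<forall>i>n. d i = 0) \<and>
          ((\<lambda>i. real (d i) * \<beta> powi i) has_sum x) {..n} \<and>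
          (\<forall>k\<le>n. (\<Sum>\<^sub>\<infinity>i\<in>{..k}. real (d i) * \<beta> powi i) < \<beta> powi (k + 1)))"

definition Fin :: "real \<Rightarrow> real set" where
  "Fin \<beta> = {x. x \<ge> 0 \<and> (\<exists>d. is_beta_expansion \<beta> x d \<and> finite {i. d i \<noteq> 0})}"

definition int_adjoin :: "real \<Rightarrow> real set" where
  "int_adjoin \<beta> = range (\<lambda>p :: int poly. poly (map_poly of_int p) \<beta>)"

definition condition_F :: "real \<Rightarrow> bool" where
  "condition_F \<beta> \<longleftrightarrow> (\<forall>x \<in> int_adjoin \<beta>. x \<ge> 0 \<longrightarrow> x \<in> Fin \<beta>)"


section \<open>The greedy characterisation of normalised expansions\<close>

lemma seq_val_eq_sum:
  assumes "\<forall>i>k. g i = 0"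
  shows "seq_val U g = (\<Sum>i\<le>k. g i * U i)"
  unfolding seq_val_def
  by (rule sum.mono_neutral_left) (use assms linorder_not_less in auto)

lemma finite_seqs_iff: "g \<in> finite_seqs \<longleftrightarrow> (\<exists>k. \<forall>i>k. g i = 0)"
  for g :: "nat \<Rightarrow> 'a::zero"
proof
  assume "g \<in> finite_seqs"
  then obtain k where "\<forall>i\<in>{i. g i \<noteq> 0}. i \<le> k"
    unfolding finite_seqs_def by (auto simp: finite_nat_set_iff_bounded_le)
  then show "\<exists>k. \<forall>i>k. g i = 0" by (meson mem_Collect_eq not_le)
next
  assume "\<exists>k. \<forall>i>k. g i = 0"
  then obtain k where "\<forall>i>k. g i = 0" by blast
  then have "{i. g i \<noteq> 0} \<subseteq> {..k}" using linorder_not_less by auto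
  then show "g \<in> finite_seqs" unfolding finite_seqs_def by (simp add: finite_subset)
qed

lemma represents_iff:
  assumes "\<forall>i>k. d i = 0"
  shows "represents U d n \<longleftrightarrow> (\<Sum>i\<le>k. int (d i) * U i) = int n"
  using assms seq_val_eq_sum[of k "\<lambda>i. int (d i)" U]
  by (auto simp: represents_def finite_seqs_iff)

definition greedy_bound :: "(nat \<Rightarrow> int) \<Rightarrow> (nat \<Rightarrow> nat) \<Rightarrow> bool" where
  "greedy_bound U d \<longleftrightarrow> (\<forall>l. (\<Sum>i\<le>l. int (d i) * U i) < U (Suc l))"

lemma lex_less_irrefl: "\<not> lex_less d d"
  by (simp add: lex_less_def)

lemma lex_less_asym: "lex_less d e \<Longrightarrow> \<not> lex_less e d"
  unfolding lex_less_def by (metis less_asym linorder_neqE_nat order_less_irrefl)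

lemma is_normalised_unique:
  "is_normalised U n d \<Longrightarrow> is_normalised U n e \<Longrightarrow> d = e"
  unfolding is_normalised_def using lex_less_asym by blast

lemma greedy_bound_imp_is_normalised:
  assumes U: "U 0 = 1" "\<And>i. U i > 0"
    and d: "represents U d n" "greedy_bound U d"
  shows "is_normalised U n d"
  unfolding is_normalised_def
proof (intro conjI allI impI)
  fix e assume e: "represents U e n"
  show "e = d \<or> lex_less e d"
  proof (rule ccontr)
    assume contra: "\<not> (e = d \<or> lex_less e d)"
    obtain a b where a: "\<forall>i>a. d i = 0" and b: "\<forall>i>b. e i = 0"
      using d(1) e by (auto simp: represents_def finite_seqs_iff)
    define D where "D = {i. d i \<noteq> e i}"
    have "D \<subseteq> {..max a b}"
    proof
      fix i assume "i \<in> D"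
      then have "d i \<noteq> e i" by (simp add: D_def)
      then have "\<not> i > max a b" using a b by (metis max_less_iff_conj)
      then show "i \<in> {..max a b}" by (simp only: atMost_iff not_less)
    qed
    then have fin: "finite D" by (rule finite_subset) simp
    have ne: "D \<noteq> {}" using contra by (auto simp: D_def)
    define k where "k = Max D"
    have k: "d k \<noteq> e k" using Max_in[OF fin ne] by (simp add: k_def D_def)
    have above: "d i = e i" if "i > k" for i
      using Max_ge[OF fin, of i] that by (force simp: k_def D_def)
    have less: "d k < e k"
      using k contra above by (metis lex_less_def linorder_neqE_nat)
    define m where "m = max k (max a b)"
    have split: "(\<Sum>i\<le>m. f i) = (\<Sum>i<k. f i) + f k + (\<Sum>i\<in>{k<..m}. f i)"
      for f :: "nat \<Rightarrow> int"
    proof -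
      have "{..m} = insert k {..<k} \<union> {k<..m}" by (auto simp: m_def)
      moreover have "insert k {..<k} \<inter> {k<..m} = {}" by auto
      ultimately have "(\<Sum>i\<le>m. f i) = (\<Sum>i\<in>insert k {..<k}. f i) + (\<Sum>i\<in>{k<..m}. f i)"
        by (simp only: sum.union_disjoint finite_insert finite_lessThan finite_greaterThanAtMost)
      then show ?thesis by simp
    qed
    have "(\<Sum>i\<le>m. int (d i) * U i) = (\<Sum>i\<le>m. int (e i) * U i)"
      using represents_iff[of m d U n] represents_iff[of m e U n] d(1) e a b
      by (simp add: m_def)
    moreover have "(\<Sum>i\<in>{k<..m}. int (d i) * U i) = (\<Sum>i\<in>{k<..m}. int (e i) * U i)"
      by (rule sum.cong) (auto simp: above)
    ultimately have eq: "(\<Sum>i<k. int (d i) * U i) + int (d k) * U k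
        = (\<Sum>i<k. int (e i) * U i) + int (e k) * U k"
      by (simp add: split)
    have "(\<Sum>i<k. int (d i) * U i) < U k"
    proof (cases k)
      case 0
      then show ?thesis using U by simp
    next
      case (Suc l)
      then show ?thesis using d(2) by (simp add: greedy_bound_def lessThan_Suc_atMost)
    qed
    moreover have "(\<Sum>i<k. int (e i) * U i) \<ge> 0"
      by (intro sum_nonneg mult_nonneg_nonneg) (simp_all add: U(2) less_imp_le)
    moreover have "(int (d k) + 1) * U k \<le> int (e k) * U k"
      using less U(2)[of k] by (intro mult_right_mono) auto
    ultimately show False using eq by (simp add: algebra_simps)
  qed
qed (use d in simp)

lemma greedy_exists:
  assumes U: "U 0 = 1" "\<And>i. U i > 0" and fin: "\<And>m. finite {i. U i \<le> m}"
  shows "\<exists>d. represents U d n \<and> greedy_bound U d"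
proof (induction n rule: less_induct)
  case (less n)
  show ?case
  proof (cases "n = 0")
    case True
    have "represents U (\<lambda>_. 0) n \<and> greedy_bound U (\<lambda>_. 0)"
      using True U(2) represents_iff[of 0 "\<lambda>_. 0" U n] by (auto simp: greedy_bound_def)
    then show ?thesis by blast
  next
    case False
    define S where "S = {i. U i \<le> int n}"
    define k where "k = Max S"
    have "finite S" "0 \<in> S" using fin U(1) False by (auto simp: S_def)
    then have kS: "k \<in> S" and kmax: "\<And>i. i \<in> S \<Longrightarrow> i \<le> k"
      unfolding k_def by (auto intro: Max_in)
    define r where "r = nat (int n - U k)"
    have r: "int r = int n - U k" using kS by (simp add: r_def S_def)
    have "r < n" using r U(2)[of k] by linarith
    then obtain d where d: "represents U d r" "greedy_bound U d" using less by blast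
    obtain a where a: "\<forall>i>a. d i = 0"
      using d(1) by (auto simp: represents_def finite_seqs_iff)
    define e where "e = d(k := Suc (d k))"
    have sum_e: "(\<Sum>i\<le>l. int (e i) * U i) = (\<Sum>i\<le>l. int (d i) * U i) + U k" if "l \<ge> k" for l
    proof -
      have "(\<Sum>i\<le>l. int (e i) * U i) = (\<Sum>i\<le>l. int (d i) * U i + (if i = k then U k else 0))"
        by (rule sum.cong) (auto simp: e_def algebra_simps)
      then show ?thesis using that by (simp add: sum.distrib)
    qed
    have rep: "(\<Sum>i\<le>m. int (e i) * U i) = int n" if "m \<ge> max a k" for m
      using represents_iff[of m d U r] d(1) a that sum_e[of m] r by auto
    have "\<forall>i>max a k. e i = 0" using a by (auto simp: e_def)
    then have "represents U e n" using represents_iff rep by blast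
    moreover have "(\<Sum>i\<le>l. int (e i) * U i) < U (Suc l)" for l
    proof (cases "l < k")
      case True
      then have "(\<Sum>i\<le>l. int (e i) * U i) = (\<Sum>i\<le>l. int (d i) * U i)"
        by (intro sum.cong) (auto simp: e_def)
      then show ?thesis using d(2) by (simp add: greedy_bound_def)
    next
      case False
      have "(\<Sum>i\<le>l. int (e i) * U i) \<le> (\<Sum>i\<le>max l (max a k). int (e i) * U i)"
        by (rule sum_mono2) (auto simp: U(2) less_imp_le)
      also have "\<dots> = int n" by (rule rep) simp
      also have "\<dots> < U (Suc l)" using kmax[of "Suc l"] False by (force simp: S_def)
      finally show ?thesis .
    qed
    ultimately show ?thesis by (auto simp: greedy_bound_def)
  qed
qed

proposition normalised_eq_iff:
  assumes U: "U 0 = 1" "\<And>i. U i > 0" and fin: "\<And>m. finite {i. U i \<le> m}"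
  shows "normalised U n = d \<longleftrightarrow> represents U d n \<and> greedy_bound U d"
proof -
  obtain e where e: "represents U e n" "greedy_bound U e"
    using greedy_exists[of U n] assms by blast
  have "is_normalised U n e" using greedy_bound_imp_is_normalised[of U] U e by blast
  then have "normalised U n = e"
    unfolding normalised_def by (blast intro: is_normalised_unique)
  moreover have "d = e" if "represents U d n" "greedy_bound U d"
    using greedy_bound_imp_is_normalised[of U d n] U that \<open>is_normalised U n e\<close>
      is_normalised_unique by blast
  ultimately show ?thesis using e by blast
qed

end

theory Submission
  imports
    Defs
    "HOL-Computational_Algebra.Field_as_Ring"
    "HOL-Computational_Algebra.Polynomial_Factorial"
    "HOL-Computational_Algebra.Fundamental_Theorem_Algebra"
begin

text \<open>
  Let \<open>g\<close> be a finite sequence with digits bounded by \<open>c\<close> and let \<open>m\<close> be its order. Up to replacing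
  \<open>g\<close> by \<open>- g\<close>, the integer \<open>n = [g]\<^sub>U\<close> is non-negative; let \<open>e\<close> be its greedy expansion. Subtract from
  \<open>g\<close> the digits of \<open>e\<close> at places \<open>\<ge> m\<close>. The difference is a shift by \<open>m\<close> of the coefficient
  sequence of an integer polynomial \<open>Q\<close>, and its value is exactly the number represented by the low
  part \<open>(e\<^sub>i)\<close>, \<open>i < m\<close>, of the greedy expansion; hence this value lies in \<open>[0, u\<^sub>m]\<close>.

  The key point is that \<open>z = Q(\<beta>)\<close> can take only finitely many values, independently of \<open>g\<close> and \<open>m\<close>.
  The digits of \<open>e\<close> are bounded, so the coefficients of \<open>Q\<close> are bounded, and so are the conjugates
  \<open>Q(\<alpha>)\<close> because \<open>|\<alpha>| < 1\<close>. The sequence \<open>U\<close> is a power sum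
  \<open>u\<^sub>n = \<Sum>\<^sub>\<alpha> C\<^sub>\<alpha> \<alpha>\<^sup>n\<close> over the roots of the minimal polynomial, with
  \<open>C\<^sub>\<beta> > 0\<close>, so the value of the shifted polynomial is
  \<open>C\<^sub>\<beta> \<beta>\<^sup>m z\<close> up to a bounded error; as it is at most \<open>u\<^sub>m = O(\<beta>\<^sup>m)\<close>, the number \<open>z\<close>
  is bounded too. An algebraic integer in \<open>\<int>[\<beta>]\<close> all of whose conjugates are bounded has finitely
  many possible values (\<open>finite_values_bounded_conjugates\<close>, \<open>finite_window_values\<close>).

  It remains to treat a single \<open>z\<close>. If \<open>z < 0\<close>, the value is negative as soon as \<open>m\<close> is large, which is
  excluded. If \<open>z \<ge> 0\<close>, Condition F provides a finite \<open>\<beta>\<close>-expansion of \<open>z\<close>, reaching down to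
  \<open>\<beta>\<close> to the power \<open>-L\<close>, say. The identity \<open>z = \<Sum>\<^sub>i d\<^sub>i \<beta>\<^sup>i\<close> carries over to all
  conjugates, so the digits \<open>d\<close>, shifted by \<open>m\<close>, represent the same integer in the system \<open>U\<close>. The
  shifted digits are even \<open>U\<close>-greedy for large \<open>m\<close>: the greedy condition consists of finitely many
  strict inequalities, each of which holds for \<open>\<beta>\<close> and hence, since \<open>u\<^sub>k \<sim> C\<^sub>\<beta> \<beta>\<^sup>k\<close>, eventually
  for \<open>U\<close>. By uniqueness of greedy expansions the low part of \<open>e\<close> is this shift, which vanishes
  below \<open>m - L\<close> (\<open>greedy_of_nonneg_element\<close>). Taking the maximum of the thresholds over the
  finitely many \<open>z\<close> gives the constant for \<open>c\<close>.
\<close>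

section \<open>Integer polynomials at conjugate points\<close>

lemma poly_map_poly_add:
  assumes "f 0 = 0" "\<And>a b. f (a + b) = f a + f b"
  shows "poly (map_poly f (p + q)) x = poly (map_poly f p) x + poly (map_poly f q) (x :: 'b :: comm_ring_1)"
proof -
  have "map_poly f (p + q) = map_poly f p + map_poly f q"
    by (rule poly_eqI) (simp add: coeff_map_poly assms)
  then show ?thesis by simp
qed

lemma poly_map_poly_mult:
  fixes f :: "'a :: comm_ring_1 \<Rightarrow> 'b :: comm_ring_1"
  assumes f: "f 0 = 0" "\<And>a b. f (a + b) = f a + f b" "\<And>a b. f (a * b) = f a * f b"
  shows "poly (map_poly f (p * q)) x = poly (map_poly f p) x * poly (map_poly f q) x"
proof (induction p)
  case (pCons a p)
  have "map_poly f (smult a q) = smult (f a) (map_poly f q)"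
    by (rule map_poly_smult) (simp_all add: f)
  then show ?case
    using pCons
    by (simp add: mult_pCons_left poly_map_poly_add f(1,2) map_poly_pCons algebra_simps)
qed (simp add: f)

abbreviation int_eval :: "int poly \<Rightarrow> 'a :: comm_ring_1 \<Rightarrow> 'a" where
  "int_eval Q x \<equiv> poly (map_poly of_int Q) x"

lemma int_eval_add: "int_eval (p + q) x = int_eval p x + int_eval q x"
  by (rule poly_map_poly_add) simp_all

lemma int_eval_mult: "int_eval (p * q) x = int_eval p x * int_eval q x"
  by (rule poly_map_poly_mult) simp_all

lemma int_eval_minus: "int_eval (- p) x = - int_eval p x"
  using int_eval_add[of p "- p" x] by (simp add: add_eq_0_iff)

lemma int_eval_diff: "int_eval (p - q) x = int_eval p x - int_eval q x"
  using int_eval_add[of p "- q" x] by (simp add: int_eval_minus)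

lemma int_eval_altdef:
  fixes x :: "'a :: comm_ring_1"
  assumes "\<forall>i>n. coeff Q i = 0"
  shows "int_eval Q x = (\<Sum>i\<le>n. of_int (coeff Q i) * x ^ i)"
proof -
  have "int_eval Q x = (\<Sum>i\<le>degree (map_poly of_int Q :: 'a poly). of_int (coeff Q i) * x ^ i)"
    by (simp add: poly_altdef coeff_map_poly)
  also have "\<dots> = (\<Sum>i\<le>n. of_int (coeff Q i) * x ^ i)"
  proof (rule sum.mono_neutral_left)
    have "degree (map_poly of_int Q :: 'a poly) \<le> n"
      using assms by (intro degree_le) (simp add: coeff_map_poly)
    then show "{..degree (map_poly of_int Q :: 'a poly)} \<subseteq> {..n}" by auto
    show "\<forall>i\<in>{..n} - {..degree (map_poly of_int Q :: 'a poly)}. of_int (coeff Q i) * x ^ i = 0"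
    proof
      fix i assume "i \<in> {..n} - {..degree (map_poly of_int Q :: 'a poly)}"
      then have "coeff (map_poly of_int Q :: 'a poly) i = 0" by (intro coeff_eq_0) auto
      then show "of_int (coeff Q i) * x ^ i = 0" by (simp add: coeff_map_poly)
    qed
  qed simp
  finally show ?thesis .
qed

lemma int_eval_of_real: "int_eval Q (of_real x :: complex) = of_real (int_eval Q x)"
  by (induction Q) (simp_all add: map_poly_pCons)

text \<open>
  Otherwise \<open>p\<close> and \<open>q\<close> are coprime, and a Bezout identity evaluated at the common root reads \<open>0 = 1\<close>.
\<close>
lemma irreducible_rat_poly_dvd:
  fixes p q :: "rat poly" and z :: "'a :: field_char_0"
  assumes p: "irreducible p"
    and z: "poly (map_poly of_rat p) z = 0" "poly (map_poly of_rat q) z = 0"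
  shows "p dvd q"
proof (rule ccontr)
  assume "\<not> p dvd q"
  then have "coprime p q"
    using p by (simp add: irreducible_imp_prime_elem_gcd prime_elem_imp_coprime)
  then obtain a b where "a * p + b * q = 1"
    using bezout_coefficients_fst_snd[of p q] by (metis coprime_iff_gcd_eq_1)
  then have "poly (map_poly of_rat (a * p + b * q)) z = 1" by simp
  then show False
    by (simp add: poly_map_poly_add poly_map_poly_mult of_rat_add of_rat_mult z)
qed

lemma map_poly_of_rat_of_int:
  "map_poly of_rat (map_poly of_int Q) = (map_poly of_int Q :: 'a :: field_char_0 poly)"
  by (rule poly_eqI) (simp add: coeff_map_poly)

text \<open>
  This is the Galois action without automorphisms: an identity between integer polynomials at one root
  of \<open>P\<close> holds at every other root, also in another field. It transports identities in \<open>\<int>[\<beta>]\<close> to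
  the complex conjugates.
\<close>
lemma int_eval_conjugate_zero:
  fixes z :: "'a :: field_char_0" and w :: "'b :: field_char_0"
  assumes P: "irreducible (map_poly of_int P :: rat poly)"
    and "int_eval P z = 0" "int_eval Q z = 0" "int_eval P w = 0"
  shows "int_eval Q w = 0"
proof -
  have "(map_poly of_int P :: rat poly) dvd map_poly of_int Q"
    using assms by (intro irreducible_rat_poly_dvd[OF P, of z]) (simp_all add: map_poly_of_rat_of_int)
  then obtain r where "map_poly of_int Q = (map_poly of_int P :: rat poly) * r" ..
  then have "poly (map_poly of_rat (map_poly of_int Q)) w
      = poly (map_poly of_rat (map_poly of_int P)) w * poly (map_poly of_rat r) w"
    by (simp add: poly_map_poly_mult of_rat_add of_rat_mult)
  then show ?thesis using assms(4) by (simp add: map_poly_of_rat_of_int)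
qed

lemma degree_map_poly_of_int: "degree (map_poly of_int P :: 'a :: ring_char_0 poly) = degree P"
  by (cases "P = 0") (simp_all add: degree_map_poly)

definition complex_roots :: "int poly \<Rightarrow> complex set" where
  "complex_roots P = {\<alpha>. int_eval P \<alpha> = 0}"

text \<open>
  The roots are simple: a common root of \<open>P\<close> and its derivative would make \<open>P\<close> divide a non-zero
  polynomial of smaller degree.
\<close>
lemma card_complex_roots_irreducible:
  assumes P: "irreducible (map_poly of_int P :: rat poly)" and deg: "degree P > 0"
  shows "card (complex_roots P) = degree P"
proof -
  let ?p = "map_poly of_int P :: complex poly" and ?q = "map_poly of_int P :: rat poly"
  have "rsquarefree ?p"
    unfolding rsquarefree_roots
  proof (intro allI notI, elim conjE)
    fix a assume a: "poly ?p a = 0" "poly (pderiv ?p) a = 0"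
    have "map_poly of_rat (pderiv ?q) = pderiv ?p"
      by (rule poly_eqI) (simp add: coeff_map_poly coeff_pderiv of_rat_mult of_rat_add)
    then have "?q dvd pderiv ?q"
      using a by (intro irreducible_rat_poly_dvd[OF P, of a]) (simp_all add: map_poly_of_rat_of_int)
    moreover have "degree ?q > 0" using deg by (simp add: degree_map_poly_of_int)
    ultimately show False using not_dvd_pderiv by blast
  qed
  then have eq: "smult (lead_coeff ?p) (\<Prod>z|poly ?p z = 0. [:-z, 1:]) = ?p"
    by (rule complex_poly_decompose_rsquarefree)
  have "lead_coeff ?p \<noteq> 0"
    using deg by (auto simp: degree_map_poly_of_int coeff_map_poly)
  then have "degree ?p = degree (\<Prod>z|poly ?p z = 0. [:-z, 1:])"
    by (subst eq[symmetric]) simp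
  also have "\<dots> = card {z. poly ?p z = 0}"
    by (subst degree_prod_eq_sum_degree) auto
  finally show ?thesis by (simp add: degree_map_poly_of_int complex_roots_def)
qed

section \<open>Finiteness of bounded sets of conjugates\<close>

definition lagrange_basis :: "'a :: field set \<Rightarrow> 'a \<Rightarrow> 'a poly" where
  "lagrange_basis A a = smult (inverse (\<Prod>b\<in>A - {a}. a - b)) (\<Prod>b\<in>A - {a}. [:- b, 1:])"

lemma poly_lagrange_basis:
  assumes "finite A" "a \<in> A" "b \<in> A"
  shows "poly (lagrange_basis A a) b = (if a = b then 1 else 0)"
  using assms by (auto simp: lagrange_basis_def poly_prod)

lemma degree_lagrange_basis:
  assumes "finite A" "a \<in> A"
  shows "degree (lagrange_basis A a) < card A"
proof -
  have "degree (lagrange_basis A a) \<le> degree (\<Prod>b\<in>A - {a}. [:- b, 1:])"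
    unfolding lagrange_basis_def by (rule degree_smult_le)
  also have "\<dots> = card (A - {a})"
    by (subst degree_prod_eq_sum_degree) auto
  also have "\<dots> < card A" using assms by (rule card_Diff1_less)
  finally show ?thesis .
qed

lemma lagrange_interpolation:
  fixes q :: "'a :: field poly"
  assumes "finite A" "degree q < card A"
  shows "q = (\<Sum>a\<in>A. smult (poly q a) (lagrange_basis A a))"
proof (rule poly_eqI_degree[where A = A])
  fix x assume "x \<in> A"
  have "poly (\<Sum>a\<in>A. smult (poly q a) (lagrange_basis A a)) x
      = (\<Sum>a\<in>A. if x = a then poly q a else 0)"
    unfolding poly_sum using assms(1) \<open>x \<in> A\<close>
    by (intro sum.cong) (auto simp: poly_lagrange_basis)
  then show "poly q x = poly (\<Sum>a\<in>A. smult (poly q a) (lagrange_basis A a)) x"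
    using assms(1) \<open>x \<in> A\<close> by simp
next
  show "degree (\<Sum>a\<in>A. smult (poly q a) (lagrange_basis A a)) < card A"
    using assms degree_lagrange_basis[of A]
    by (intro degree_sum_less) (auto intro: le_less_trans[OF degree_smult_le])
qed (rule assms(2))

lemma degree_min_poly_pos:
  assumes "is_min_poly \<beta> P"
  shows "degree P > 0"
proof (rule ccontr)
  assume "\<not> degree P > 0"
  then have "P = [:1:]" using assms degree_0_id[of P] by (simp add: is_min_poly_def)
  then show False using assms by (simp add: is_min_poly_def map_poly_pCons)
qed

text \<open>
  Pseudo-division scales the dividend by a power of the leading coefficient of the divisor, here
  by \<open>1\<close>, so the remainder stays integral.
\<close>
lemma monic_int_poly_remainder:
  fixes P Q :: "int poly"
  assumes "lead_coeff P = 1"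
  obtains S R where "Q = P * S + R" "R = 0 \<or> degree R < degree P"
proof -
  obtain S R where "pseudo_divmod Q P = (S, R)" by fastforce
  moreover have "P \<noteq> 0" using assms by auto
  ultimately show ?thesis using pseudo_divmod[of P Q S R] assms by (intro that) auto
qed

lemma finite_int_polys_bounded:
  "finite {R :: int poly. degree R < d \<and> (\<forall>i. \<bar>coeff R i\<bar> \<le> B)}"
proof (rule finite_subset)
  show "{R :: int poly. degree R < d \<and> (\<forall>i. \<bar>coeff R i\<bar> \<le> B)}
      \<subseteq> Poly ` {xs. set xs \<subseteq> {-B..B} \<and> length xs \<le> d}"
  proof
    fix R :: "int poly" assume R: "R \<in> {R. degree R < d \<and> (\<forall>i. \<bar>coeff R i\<bar> \<le> B)}"
    have "set (coeffs R) \<subseteq> {-B..B}"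
    proof
      fix x assume "x \<in> set (coeffs R)"
      then obtain i where "x = coeff R i" by (auto simp: coeffs_def split: if_splits)
      moreover have "\<bar>coeff R i\<bar> \<le> B" using R by simp
      ultimately show "x \<in> {-B..B}" by auto
    qed
    moreover have "length (coeffs R) \<le> d" using R by (cases "R = 0") (auto simp: length_coeffs)
    ultimately show "R \<in> Poly ` {xs. set xs \<subseteq> {-B..B} \<and> length xs \<le> d}"
      by (intro image_eqI[of _ _ "coeffs R"]) auto
  qed
qed (intro finite_imageI finite_lists_length_le finite_atLeastAtMost_int)

text \<open>
  Reducing \<open>Q\<close> modulo \<open>P\<close> does not change its values at the roots. The remainder has degree less than
  the number of roots, so Lagrange interpolation bounds its coefficients in terms of these values, and
  only finitely many integer polynomials satisfy such a bound.
\<close>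
lemma finite_values_bounded_conjugates:
  fixes \<beta> :: real
  assumes P: "is_min_poly \<beta> P"
  defines "A \<equiv> complex_roots P"
  shows "finite {int_eval Q \<beta> | Q. \<forall>\<alpha>\<in>A. norm (int_eval Q \<alpha>) \<le> M}"
proof -
  have irr: "irreducible (map_poly of_int P :: rat poly)" and lead: "lead_coeff P = 1"
    and root: "int_eval P \<beta> = 0" using P by (auto simp: is_min_poly_def)
  have deg: "degree P > 0" by (rule degree_min_poly_pos[OF P])
  have card: "card A = degree P" unfolding A_def by (rule card_complex_roots_irreducible[OF irr deg])
  then have fin: "finite A" using deg by (metis card.infinite not_gr_zero)
  define B where "B = (\<Sum>\<alpha>\<in>A. \<Sum>i<degree P. M * norm (coeff (lagrange_basis A \<alpha>) i))"
  have "{int_eval Q \<beta> | Q. \<forall>\<alpha>\<in>A. norm (int_eval Q \<alpha>) \<le> M}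
      \<subseteq> (\<lambda>R. int_eval R \<beta>) ` {R. degree R < degree P \<and> (\<forall>i. \<bar>coeff R i\<bar> \<le> \<lfloor>B\<rfloor>)}"
  proof clarify
    fix Q assume Q: "\<forall>\<alpha>\<in>A. norm (int_eval Q \<alpha>) \<le> M"
    obtain S R where SR: "Q = P * S + R" and R0: "R = 0 \<or> degree R < degree P"
      using monic_int_poly_remainder[OF lead] .
    have degR: "degree R < degree P" using R0 deg by auto
    have ev: "int_eval R \<alpha> = int_eval Q \<alpha>" if "\<alpha> \<in> A" for \<alpha>
      using that by (simp add: SR A_def complex_roots_def int_eval_add int_eval_mult)
    have evb: "int_eval R \<beta> = int_eval Q \<beta>"
      using root by (simp add: SR int_eval_add int_eval_mult)
    let ?R = "map_poly of_int R :: complex poly"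
    have interp: "?R = (\<Sum>\<alpha>\<in>A. smult (poly ?R \<alpha>) (lagrange_basis A \<alpha>))"
      using fin degR card by (intro lagrange_interpolation) (simp_all add: degree_map_poly_of_int)
    have bound: "\<bar>coeff R i\<bar> \<le> \<lfloor>B\<rfloor>" for i
    proof (cases "i < degree P")
      case True
      have M0: "M \<ge> 0" if "\<alpha> \<in> A" for \<alpha> using Q that norm_ge_zero order_trans by blast
      have "real_of_int \<bar>coeff R i\<bar> = norm (coeff ?R i)"
        by (simp add: coeff_map_poly)
      also have "\<dots> = norm (\<Sum>\<alpha>\<in>A. int_eval R \<alpha> * coeff (lagrange_basis A \<alpha>) i)"
        by (subst interp) (simp add: coeff_sum)
      also have "\<dots> \<le> (\<Sum>\<alpha>\<in>A. M * norm (coeff (lagrange_basis A \<alpha>) i))"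
        using Q ev by (intro sum_norm_le) (auto simp: norm_mult intro!: mult_right_mono)
      also have "\<dots> \<le> B" unfolding B_def
        using True M0 by (intro sum_mono member_le_sum) auto
      finally show ?thesis by (simp add: le_floor_iff)
    next
      case False
      have "0 \<le> B" unfolding B_def
        using Q by (intro sum_nonneg mult_nonneg_nonneg) (auto intro: order_trans[OF norm_ge_zero])
      then show ?thesis using False degR by (simp add: coeff_eq_0)
    qed
    show "int_eval Q \<beta> \<in> (\<lambda>R. int_eval R \<beta>) ` {R. degree R < degree P \<and> (\<forall>i. \<bar>coeff R i\<bar> \<le> \<lfloor>B\<rfloor>)}"
      using degR bound evb by (intro image_eqI[of _ _ R]) auto
  qed
  then show ?thesis by (rule finite_subset) (intro finite_imageI finite_int_polys_bounded)
qed

section \<open>Power sums for linear recurrences\<close>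

definition poly_upto :: "(nat \<Rightarrow> int) \<Rightarrow> nat \<Rightarrow> int poly" where
  "poly_upto f n = (\<Sum>i\<le>n. monom (f i) i)"

lemma coeff_poly_upto: "coeff (poly_upto f n) i = (if i \<le> n then f i else 0)"
proof -
  have "coeff (poly_upto f n) i = (\<Sum>j\<le>n. if j = i then f j else 0)"
    by (simp add: poly_upto_def coeff_sum coeff_monom)
  then show ?thesis by simp
qed

lemma int_eval_poly_upto: "int_eval (poly_upto f n) x = (\<Sum>i\<le>n. of_int (f i) * x ^ i)"
  by (subst int_eval_altdef[of n]) (auto simp: coeff_poly_upto intro!: sum.cong)

text \<open>
  The value \<open>[X\<^sup>k Q]\<^sub>U\<close> of the coefficient sequence of \<open>Q\<close> moved up by \<open>k\<close> places. Working with
  polynomials rather than with digit sequences makes evaluation at the conjugates available.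
\<close>
definition window_sum :: "(nat \<Rightarrow> int) \<Rightarrow> nat \<Rightarrow> int poly \<Rightarrow> int" where
  "window_sum U k Q = (\<Sum>i\<le>degree Q. coeff Q i * U (k + i))"

lemma window_sum_altdef:
  assumes "\<forall>i>n. coeff Q i = 0"
  shows "window_sum U k Q = (\<Sum>i\<le>n. coeff Q i * U (k + i))"
proof -
  have "degree Q \<le> n" using assms by (intro degree_le) auto
  then show ?thesis unfolding window_sum_def
    by (intro sum.mono_neutral_left) (auto simp: coeff_eq_0)
qed

lemma window_sum_poly_upto: "window_sum U k (poly_upto f n) = (\<Sum>i\<le>n. f i * U (k + i))"
  by (subst window_sum_altdef[of n]) (auto simp: coeff_poly_upto intro!: sum.cong)

lemma window_sum_diff: "window_sum U k (p - q) = window_sum U k p - window_sum U k q"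
proof -
  have "\<forall>i>max (degree p) (degree q). coeff p i = 0"
    "\<forall>i>max (degree p) (degree q). coeff q i = 0" by (auto intro: coeff_eq_0)
  then show ?thesis
    by (subst (1 2 3) window_sum_altdef[of "max (degree p) (degree q)"])
      (auto simp: sum_subtractf algebra_simps)
qed

lemma window_sum_minus: "window_sum U k (- p) = - window_sum U k p"
  by (simp add: window_sum_def sum_negf)

lemma window_sum_monom: "window_sum U k (monom a n) = a * U (k + n)"
proof -
  have "window_sum U k (monom a n) = (\<Sum>i\<le>n. if i = n then a * U (k + n) else 0)"
    unfolding window_sum_altdef[of n "monom a n", simplified] by (rule sum.cong) auto
  then show ?thesis by simp
qed

lemma int_eval_monom: "int_eval (monom a n) x = of_int a * x ^ n"
  by (simp add: map_poly_monom poly_monom)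

text \<open>
  The coefficients come from Lagrange interpolation instead of inverting a Vandermonde matrix:
  interpolating \<open>X\<^sup>n\<close> for \<open>n < d\<close> at the roots gives \<open>X\<^sup>n = \<Sum>\<^sub>\<alpha> \<alpha>\<^sup>n L\<^sub>\<alpha>\<close>, and comparing
  coefficients shows that the power sum has the right \<open>d\<close> initial values. Both sides satisfy the same
  recurrence. The recurrence refers back to index \<open>1 - d\<close>, so the argument is run for the sequence
  shifted by \<open>d - 1\<close>.
\<close>
lemma pisot_numeration_power_sum:
  assumes P: "is_min_poly \<beta> P"
    and v: "v 0 = (1::int)"
      "\<forall>n\<ge>1. v n = (\<Sum>i<degree P. - coeff P i * v (n - int (degree P) + int i))"
  shows "\<exists>C. \<forall>n. of_int (v (int n)) = (\<Sum>\<alpha>\<in>complex_roots P. C \<alpha> * \<alpha> ^ n :: complex)"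
proof -
  define A where "A = complex_roots P"
  define d where "d = degree P"
  have lead: "coeff P d = 1" using P by (simp add: is_min_poly_def d_def)
  have d0: "d > 0" unfolding d_def by (rule degree_min_poly_pos[OF P])
  have card: "card A = d" unfolding A_def d_def
    by (rule card_complex_roots_irreducible) (use P d0 in \<open>auto simp: is_min_poly_def d_def\<close>)
  then have fin: "finite A" using d0 by (metis card.infinite not_gr_zero)
  define w where "w n = v (int n - int (d - 1))" for n
  define c where "c \<alpha> = (\<Sum>j<d. of_int (w j) * coeff (lagrange_basis A \<alpha>) j)" for \<alpha>
  have w: "of_int (w n) = (\<Sum>\<alpha>\<in>A. c \<alpha> * \<alpha> ^ n)" for n
  proof (induction n rule: less_induct)
    case (less n)
    show ?case
    proof (cases "n < d")
      case True
      let ?X = "monom 1 n :: complex poly"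
      have X: "?X = (\<Sum>\<alpha>\<in>A. smult (poly ?X \<alpha>) (lagrange_basis A \<alpha>))"
        using fin True card by (intro lagrange_interpolation) (simp_all add: degree_monom_eq)
      have "(\<Sum>\<alpha>\<in>A. c \<alpha> * \<alpha> ^ n)
          = (\<Sum>\<alpha>\<in>A. \<Sum>j<d. of_int (w j) * (\<alpha> ^ n * coeff (lagrange_basis A \<alpha>) j))"
        by (simp add: c_def sum_distrib_left sum_distrib_right mult_ac)
      also have "\<dots> = (\<Sum>j<d. of_int (w j) * (\<Sum>\<alpha>\<in>A. \<alpha> ^ n * coeff (lagrange_basis A \<alpha>) j))"
        by (subst sum.swap) (simp add: sum_distrib_left)
      also have "\<dots> = (\<Sum>j<d. of_int (w j) * coeff ?X j)"
        by (subst X) (simp add: coeff_sum poly_monom)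
      also have "\<dots> = (\<Sum>j<d. if j = n then of_int (w n) else 0)"
        by (rule sum.cong) auto
      also have "\<dots> = of_int (w n)" using True by simp
      finally show ?thesis by simp
    next
      case False
      have "w n = (\<Sum>i<d. - coeff P i * w (n - d + i))"
      proof -
        have "int n - int (d - 1) \<ge> 1" using False d0 by linarith
        then have "w n = (\<Sum>i<d. - coeff P i * v (int n - int (d - 1) - int d + int i))"
          unfolding w_def using v(2) by (simp add: d_def)
        also have "\<dots> = (\<Sum>i<d. - coeff P i * w (n - d + i))"
          unfolding w_def using False by (intro sum.cong) (auto simp: of_nat_diff algebra_simps)
        finally show ?thesis .
      qed
      then have "of_int (w n) = (\<Sum>i<d. - of_int (coeff P i) * of_int (w (n - d + i)) :: complex)"
        by simp
      also have "\<dots> = (\<Sum>i<d. - of_int (coeff P i) * (\<Sum>\<alpha>\<in>A. c \<alpha> * \<alpha> ^ (n - d + i)))"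
        using False by (intro sum.cong refl arg_cong2[where f = "(*)"] less) auto
      also have "\<dots> = (\<Sum>\<alpha>\<in>A. \<Sum>i<d. - of_int (coeff P i) * (c \<alpha> * \<alpha> ^ (n - d + i)))"
        by (subst sum.swap) (simp add: sum_distrib_left)
      also have "\<dots> = (\<Sum>\<alpha>\<in>A. c \<alpha> * \<alpha> ^ n)"
      proof (rule sum.cong)
        fix \<alpha> assume "\<alpha> \<in> A"
        then have "(\<Sum>i\<le>d. of_int (coeff P i) * \<alpha> ^ i) = 0"
          using int_eval_altdef[of d P \<alpha>] by (simp add: A_def complex_roots_def d_def coeff_eq_0)
        then have \<alpha>: "(\<Sum>i<d. of_int (coeff P i) * \<alpha> ^ i) = - (\<alpha> ^ d)"
          using lead by (simp add: lessThan_Suc_atMost[symmetric] add_eq_0_iff2 add_eq_0_iff)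
        have "(\<Sum>i<d. - of_int (coeff P i) * (c \<alpha> * \<alpha> ^ (n - d + i)))
            = - (c \<alpha> * \<alpha> ^ (n - d)) * (\<Sum>i<d. of_int (coeff P i) * \<alpha> ^ i)"
          by (simp add: sum_distrib_left power_add mult_ac sum_negf)
        also have "\<dots> = c \<alpha> * \<alpha> ^ n"
          using False by (simp add: \<alpha> power_add[symmetric])
        finally show "(\<Sum>i<d. - of_int (coeff P i) * (c \<alpha> * \<alpha> ^ (n - d + i))) = c \<alpha> * \<alpha> ^ n" .
      qed simp
      finally show ?thesis .
    qed
  qed
  have "of_int (v (int n)) = (\<Sum>\<alpha>\<in>A. c \<alpha> * \<alpha> ^ (d - 1) * \<alpha> ^ n)" for n
    using w[of "n + (d - 1)"] by (simp add: w_def power_add mult_ac)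
  then show ?thesis unfolding A_def by (intro exI[of _ "\<lambda>\<alpha>. c \<alpha> * \<alpha> ^ (d - 1)"]) simp
qed

section \<open>Growth of a Pisot numeration\<close>

locale pisot_power_sum =
  fixes \<beta> :: real and P :: "int poly" and U :: "nat \<Rightarrow> int" and C :: "complex \<Rightarrow> complex"
  assumes min_poly: "is_min_poly \<beta> P"
    and beta_gt_1: "\<beta> > 1"
    and conjugate_lt_1: "\<And>\<alpha>. \<alpha> \<in> complex_roots P \<Longrightarrow> \<alpha> \<noteq> of_real \<beta> \<Longrightarrow> norm \<alpha> < 1"
    and U_0: "U 0 = 1"
    and U_pos: "\<And>n. U n > 0"
    and power_sum: "\<And>n. of_int (U n) = (\<Sum>\<alpha>\<in>complex_roots P. C \<alpha> * \<alpha> ^ n)"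
begin

abbreviation A :: "complex set" where "A \<equiv> complex_roots P"

lemma irreducible_P: "irreducible (map_poly of_int P :: rat poly)"
  and root_beta: "int_eval P \<beta> = 0"
  using min_poly by (auto simp: is_min_poly_def)

lemma degree_P: "degree P > 0"
  by (rule degree_min_poly_pos[OF min_poly])

lemma finite_A: "finite A"
  using card_complex_roots_irreducible[OF irreducible_P degree_P] degree_P
  by (metis card.infinite not_gr_zero)

lemma beta_in_A: "of_real \<beta> \<in> A"
  using root_beta by (simp add: complex_roots_def int_eval_of_real)

lemma sum_A: "(\<Sum>\<alpha>\<in>A. f \<alpha>) = f (of_real \<beta>) + (\<Sum>\<alpha>\<in>A - {of_real \<beta>}. f \<alpha>)"
  by (rule sum.remove[OF finite_A beta_in_A])

lemma window_sum_power_sum: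
  "of_int (window_sum U k Q) = (\<Sum>\<alpha>\<in>A. C \<alpha> * \<alpha> ^ k * int_eval Q \<alpha>)"
proof -
  have ev: "int_eval Q \<alpha> = (\<Sum>i\<le>degree Q. of_int (coeff Q i) * \<alpha> ^ i)" for \<alpha> :: complex
    by (rule int_eval_altdef) (simp add: coeff_eq_0)
  have "of_int (window_sum U k Q)
      = (\<Sum>i\<le>degree Q. of_int (coeff Q i) * (\<Sum>\<alpha>\<in>A. C \<alpha> * \<alpha> ^ (k + i)))"
    by (simp add: window_sum_def power_sum)
  also have "\<dots> = (\<Sum>\<alpha>\<in>A. \<Sum>i\<le>degree Q. of_int (coeff Q i) * (C \<alpha> * \<alpha> ^ (k + i)))"
    by (subst sum.swap) (simp add: sum_distrib_left)
  also have "\<dots> = (\<Sum>\<alpha>\<in>A. C \<alpha> * \<alpha> ^ k * int_eval Q \<alpha>)"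
    unfolding ev by (simp add: sum_distrib_left power_add mult_ac)
  finally show ?thesis .
qed

text \<open>
  The value depends on the element \<open>Q(\<beta>)\<close> of \<open>\<int>[\<beta>]\<close> only, and multiplying by \<open>\<beta>\<close> amounts to
  moving up by one place. This turns \<open>\<beta>\<close>-expansions into \<open>U\<close>-representations.
\<close>
lemma window_sum_cong:
  assumes "\<beta> ^ L * int_eval Q \<beta> = int_eval D \<beta>"
  shows "window_sum U (h + L) Q = window_sum U h D"
proof -
  have "int_eval (monom 1 L * Q - D) \<beta> = 0"
    using assms by (simp add: int_eval_diff int_eval_mult int_eval_monom)
  then have "int_eval (monom 1 L * Q - D) \<alpha> = 0" if "\<alpha> \<in> A" for \<alpha>
    using int_eval_conjugate_zero[OF irreducible_P root_beta] that by (auto simp: complex_roots_def)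
  then have "\<alpha> ^ L * int_eval Q \<alpha> = int_eval D \<alpha>" if "\<alpha> \<in> A" for \<alpha>
    using that by (simp add: int_eval_diff int_eval_mult int_eval_monom)
  then have "complex_of_int (window_sum U (h + L) Q) = of_int (window_sum U h D)"
    unfolding window_sum_power_sum by (intro sum.cong) (auto simp: power_add mult.assoc)
  then show ?thesis by simp
qed

lemma window_sum_tendsto_complex:
  "(\<lambda>k. of_int (window_sum U k Q) / of_real \<beta> ^ k) \<longlonglongrightarrow> C \<beta> * int_eval Q (of_real \<beta>)"
proof -
  have eq: "of_int (window_sum U k Q) / of_real \<beta> ^ k = C \<beta> * int_eval Q (of_real \<beta>)
      + (\<Sum>\<alpha>\<in>A - {of_real \<beta>}. C \<alpha> * int_eval Q \<alpha> * (\<alpha> / of_real \<beta>) ^ k)" for k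
    unfolding window_sum_power_sum sum_A using beta_gt_1
    by (simp add: add_divide_distrib sum_divide_distrib power_divide mult_ac)
  have "(\<lambda>k. C \<alpha> * int_eval Q \<alpha> * (\<alpha> / of_real \<beta>) ^ k) \<longlonglongrightarrow> C \<alpha> * int_eval Q \<alpha> * 0"
    if "\<alpha> \<in> A - {of_real \<beta>}" for \<alpha>
  proof (intro tendsto_mult tendsto_const LIMSEQ_power_zero)
    have "norm \<alpha> < \<beta>" using conjugate_lt_1[of \<alpha>] that beta_gt_1 by auto
    then show "norm (\<alpha> / of_real \<beta>) < 1" using beta_gt_1 by (simp add: norm_divide)
  qed
  then have "(\<lambda>k. \<Sum>\<alpha>\<in>A - {of_real \<beta>}. C \<alpha> * int_eval Q \<alpha> * (\<alpha> / of_real \<beta>) ^ k)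
      \<longlonglongrightarrow> (\<Sum>\<alpha>\<in>A - {of_real \<beta>}. C \<alpha> * int_eval Q \<alpha> * 0)"
    by (intro tendsto_sum)
  from tendsto_add[OF tendsto_const this] show ?thesis unfolding eq by simp
qed

lemma window_sum_1: "window_sum U k 1 = U k"
  using window_sum_monom[of U k 1 0] by (simp add: monom_0 one_pCons)

text \<open>
  The limit of \<open>u\<^sub>k / \<beta>\<^sup>k\<close> is real and non-negative. It is not zero, for then only the contributions
  of the conjugates inside the unit disc would remain and the positive integers \<open>u\<^sub>k\<close> would tend
  to \<open>0\<close>.
\<close>
lemma C_beta_pos: obtains \<gamma> where "\<gamma> > 0" "C \<beta> = of_real \<gamma>"
proof -
  have lim: "(\<lambda>k. complex_of_real (of_int (U k) / \<beta> ^ k)) \<longlonglongrightarrow> C \<beta>"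
    using window_sum_tendsto_complex[of 1] by (simp add: window_sum_1)
  have "Im (C \<beta>) = 0"
    using tendsto_Im[OF lim] by (simp add: LIMSEQ_const_iff)
  then have real: "C \<beta> = of_real (Re (C \<beta>))" by (simp add: complex_eq_iff)
  have "Re (C \<beta>) \<ge> 0"
    using tendsto_Re[OF lim] U_pos beta_gt_1
    by (intro LIMSEQ_le_const[of "\<lambda>k. Re (complex_of_real (of_int (U k) / \<beta> ^ k))"])
      (auto intro!: divide_nonneg_nonneg simp: less_imp_le)
  moreover have "Re (C \<beta>) \<noteq> 0"
  proof
    assume "Re (C \<beta>) = 0"
    then have C0: "C \<beta> = 0" using real by simp
    have "(\<lambda>n. \<Sum>\<alpha>\<in>A - {of_real \<beta>}. C \<alpha> * \<alpha> ^ n) \<longlonglongrightarrow> (\<Sum>\<alpha>\<in>A - {of_real \<beta>}. C \<alpha> * 0)"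
      using conjugate_lt_1 by (intro tendsto_sum tendsto_mult tendsto_const LIMSEQ_power_zero) auto
    then have "(\<lambda>n. complex_of_int (U n)) \<longlonglongrightarrow> 0"
      unfolding power_sum sum_A by (simp add: C0)
    from tendsto_norm[OF this] have "(\<lambda>n. real_of_int (U n)) \<longlonglongrightarrow> 0"
      using U_pos by (simp add: less_imp_le)
    then have "(1::real) \<le> 0"
      using U_pos by (intro LIMSEQ_le_const[of "\<lambda>n. real_of_int (U n)"]) (auto simp: int_one_le_iff_zero_less)
    then show False by simp
  qed
  ultimately show ?thesis using real that by force
qed

text \<open>
  Every strict inequality in \<open>\<int>[\<beta>]\<close> becomes, in \<open>U\<close>, an inequality that holds at all sufficiently
  high places.
\<close>
lemma eventually_window_sum_pos:
  assumes "int_eval Q \<beta> > 0"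
  shows "\<forall>\<^sub>F k in sequentially. window_sum U k Q > 0"
proof -
  obtain \<gamma> where \<gamma>: "\<gamma> > 0" "C \<beta> = of_real \<gamma>" by (rule C_beta_pos)
  have "(\<lambda>k. Re (of_int (window_sum U k Q) / of_real \<beta> ^ k))
      \<longlonglongrightarrow> Re (C \<beta> * int_eval Q (of_real \<beta>))"
    by (rule tendsto_Re[OF window_sum_tendsto_complex])
  moreover have "Re (of_int (window_sum U k Q) / of_real \<beta> ^ k) = of_int (window_sum U k Q) / \<beta> ^ k" for k
  proof -
    have "of_int (window_sum U k Q) / of_real \<beta> ^ k = complex_of_real (of_int (window_sum U k Q) / \<beta> ^ k)"
      by simp
    then show ?thesis by (simp only: Re_complex_of_real)
  qed
  ultimately have "(\<lambda>k. of_int (window_sum U k Q) / \<beta> ^ k) \<longlonglongrightarrow> \<gamma> * int_eval Q \<beta>"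
    by (simp add: \<gamma> int_eval_of_real)
  then have "\<forall>\<^sub>F k in sequentially. of_int (window_sum U k Q) / \<beta> ^ k > 0"
    by (rule order_tendstoD(1)) (use \<gamma> assms in simp)
  then show ?thesis
    by eventually_elim (use beta_gt_1 in \<open>simp add: zero_less_divide_iff\<close>)
qed

text \<open>This is the inequality \<open>\<beta> - 1 > 0\<close>.\<close>
lemma eventually_U_increasing: "\<forall>\<^sub>F k in sequentially. U k < U (Suc k)"
proof -
  have "\<forall>\<^sub>F k in sequentially. window_sum U k (monom 1 1 - monom 1 0) > 0"
    using beta_gt_1 by (intro eventually_window_sum_pos) (simp add: int_eval_diff int_eval_monom)
  then show ?thesis by (simp add: window_sum_diff window_sum_monom window_sum_1)
qed

lemma finite_U_le: "finite {i. U i \<le> m}"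
proof -
  obtain k where k: "\<And>i. i \<ge> k \<Longrightarrow> U i < U (Suc i)"
    using eventually_U_increasing unfolding eventually_sequentially by blast
  have ge: "U (k + n) > int n" for n
  proof (induction n)
    case (Suc n)
    then show ?case using k[of "k + n"] by simp
  qed (simp add: U_pos)
  have "{i. U i \<le> m} \<subseteq> {..k + nat m}"
  proof
    fix i assume i: "i \<in> {i. U i \<le> m}"
    show "i \<in> {..k + nat m}"
      using ge[of "i - k"] i by (cases "i \<le> k") auto
  qed
  then show ?thesis by (rule finite_subset) simp
qed

lemma U_ratio_bounded: obtains B where "B \<ge> 0" "\<And>k. U (Suc k) \<le> B * U k"
proof -
  \<comment> \<open>Since \<open>b > \<beta>\<close>, the constant \<open>b\<close> works from \<open>k0\<close> on; \<open>S\<close> covers the finitely many smaller indices.\<close>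
  define b where "b = \<lceil>\<beta>\<rceil> + 1"
  have "real_of_int b > \<beta>" unfolding b_def by linarith
  then have "\<forall>\<^sub>F k in sequentially. window_sum U k (monom b 0 - monom 1 1) > 0"
    by (intro eventually_window_sum_pos) (simp add: int_eval_diff int_eval_monom)
  then obtain k0 where k0: "\<And>k. k \<ge> k0 \<Longrightarrow> U (Suc k) \<le> b * U k"
    unfolding eventually_sequentially by (force simp: window_sum_diff window_sum_monom)
  have b: "b \<ge> 0" using beta_gt_1 unfolding b_def by linarith
  define S where "S = (\<Sum>k<k0. U (Suc k))"
  have S: "S \<ge> 0" unfolding S_def by (intro sum_nonneg) (simp add: U_pos less_imp_le)
  show ?thesis
  proof (rule that)
    show "b + S \<ge> 0" using b S by simp
    fix k
    show "U (Suc k) \<le> (b + S) * U k"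
    proof (cases "k < k0")
      case True
      have "U (Suc k) \<le> S" unfolding S_def
        using True by (intro member_le_sum) (auto simp: U_pos less_imp_le)
      also have "\<dots> \<le> (b + S) * U k"
        using b S U_pos[of k] mult_left_mono[of 1 "U k" "b + S"] by simp
      finally show ?thesis .
    next
      case False
      then have "U (Suc k) \<le> b * U k" using k0 by simp
      also have "\<dots> \<le> (b + S) * U k" using S U_pos[of k] by (simp add: distrib_right)
      finally show ?thesis .
    qed
  qed
qed

lemma greedy_digits_bounded:
  obtains B where "B \<ge> 0" "\<And>e i. greedy_bound U e \<Longrightarrow> int (e i) \<le> B"
proof -
  obtain B where B: "B \<ge> 0" "\<And>k. U (Suc k) \<le> B * U k" using U_ratio_bounded by blast
  have "int (e i) \<le> B" if "greedy_bound U e" for e i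
  proof -
    have "int (e i) * U i \<le> (\<Sum>j\<le>i. int (e j) * U j)"
      by (rule member_le_sum) (auto simp: U_pos less_imp_le)
    also have "\<dots> < U (Suc i)" using that by (simp add: greedy_bound_def)
    also have "\<dots> \<le> B * U i" by (rule B)
    finally show ?thesis using U_pos[of i] by simp
  qed
  then show ?thesis using B that by blast
qed

lemma U_le_power: obtains T where "T \<ge> 0" "\<And>n. of_int (U n) \<le> T * \<beta> ^ n"
proof -
  have "(\<lambda>k. complex_of_int (U k) / of_real \<beta> ^ k) \<longlonglongrightarrow> C \<beta>"
    using window_sum_tendsto_complex[of 1] by (simp add: window_sum_1)
  then have "Bseq (\<lambda>k. complex_of_int (U k) / of_real \<beta> ^ k)"
    by (intro convergent_imp_Bseq convergentI)
  then obtain T where T: "T > 0" "\<And>k. norm (complex_of_int (U k) / of_real \<beta> ^ k) \<le> T"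
    by (rule BseqE) blast
  have "of_int (U n) \<le> T * \<beta> ^ n" for n
    using T(2)[of n] U_pos[of n] beta_gt_1
    by (simp add: norm_divide norm_power pos_divide_le_eq)
  then show ?thesis using T that[of T] by auto
qed

end

section \<open>From finite beta-expansions to greedy expansions of integers\<close>

text \<open>
  Multiplying by \<open>\<beta>\<^sup>L\<close> clears the fractional digits, so that the expansion is described by natural
  indices and finite sums.
\<close>
lemma finite_beta_expansion:
  assumes exp: "is_beta_expansion \<beta> z d" and fin: "finite {i. d i \<noteq> 0}" and \<beta>: "\<beta> > 1"
  obtains L J D where "\<forall>j>J. D j = 0" "(\<Sum>j\<le>J. real (D j) * \<beta> ^ j) = \<beta> ^ L * z"
    "\<And>l. l \<le> J \<Longrightarrow> (\<Sum>j\<le>l. real (D j) * \<beta> ^ j) < \<beta> ^ Suc l"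
proof -
  obtain n where n: "\<forall>i>n. d i = 0"
      "((\<lambda>i. real (d i) * \<beta> powi i) has_sum z) {..n}"
      "\<forall>k\<le>n. (\<Sum>\<^sub>\<infinity>i\<in>{..k}. real (d i) * \<beta> powi i) < \<beta> powi (k + 1)"
    using exp unfolding is_beta_expansion_def by blast
  obtain b where b: "\<And>i. d i \<noteq> 0 \<Longrightarrow> b \<le> i"
    using bdd_below_finite[OF fin] unfolding bdd_below_def by auto
  define L where "L = nat (max (- b) (- n))"
  define J where "J = nat (n + int L)"
  define D where "D j = d (int j - int L)" for j
  have low: "d i = 0" if "i < - int L" for i
  proof -
    have "- int L \<le> b" using L_def by linarith
    then have "i < b" using that by linarith
    then show ?thesis using b[of i] by force
  qed
  have J: "int J = n + int L" using J_def L_def by linarith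
  have partial: "(\<Sum>j\<le>l. real (D j) * \<beta> ^ j)
      = \<beta> ^ L * (\<Sum>\<^sub>\<infinity>i\<in>{..int l - int L}. real (d i) * \<beta> powi i)" for l
  proof -
    have "(\<Sum>\<^sub>\<infinity>i\<in>{..int l - int L}. real (d i) * \<beta> powi i)
        = (\<Sum>\<^sub>\<infinity>i\<in>{- int L..int l - int L}. real (d i) * \<beta> powi i)"
      by (rule infsum_cong_neutral) (auto simp: low)
    also have "\<dots> = (\<Sum>i\<in>{- int L..int l - int L}. real (d i) * \<beta> powi i)"
      by (rule infsum_finite) simp
    also have "\<dots> = (\<Sum>j\<le>l. real (D j) * \<beta> powi (int j - int L))"
      by (rule sum.reindex_bij_witness[of _ "\<lambda>j. int j - int L" "\<lambda>i. nat (i + int L)"])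
        (auto simp: D_def)
    also have "\<dots> = (\<Sum>j\<le>l. real (D j) * \<beta> ^ j) / \<beta> ^ L"
      using \<beta> by (simp add: power_int_diff sum_divide_distrib)
    finally show ?thesis using \<beta> by simp
  qed
  show ?thesis
  proof (rule that)
    show "\<forall>j>J. D j = 0"
    proof (intro allI impI)
      fix j assume "j > J"
      then have "int j - int L > n" using J by linarith
      then show "D j = 0" using n(1) by (simp add: D_def)
    qed
    have "int J - int L = n" using J by simp
    then show "(\<Sum>j\<le>J. real (D j) * \<beta> ^ j) = \<beta> ^ L * z"
      using infsumI[OF n(2)] by (simp add: partial)
    fix l assume "l \<le> J"
    then have "int l - int L \<le> n" using J by linarith
    then have "\<beta> ^ L * (\<Sum>\<^sub>\<infinity>i\<in>{..int l - int L}. real (d i) * \<beta> powi i)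
        < \<beta> ^ L * \<beta> powi (int l - int L + 1)"
      using n(3) \<beta> by (intro mult_strict_left_mono) auto
    also have "\<dots> = \<beta> ^ L * \<beta> powi (int (Suc l) - int L)" by (simp add: algebra_simps)
    also have "\<dots> = \<beta> ^ Suc l"
      using \<beta> by (subst power_int_diff) (auto simp del: of_nat_Suc)
    finally show "(\<Sum>j\<le>l. real (D j) * \<beta> ^ j) < \<beta> ^ Suc l" by (simp add: partial)
  qed
qed

lemma seq_val_uminus: "seq_val V (\<lambda>i. - g i) = - seq_val V g"
  by (simp add: seq_val_def sum_negf)

lemma abs_le_sup_norm:
  assumes "g \<in> finite_seqs"
  shows "\<bar>g i\<bar> \<le> sup_norm g"
proof -
  have "range (\<lambda>n. \<bar>g n\<bar>) \<subseteq> insert 0 ((\<lambda>n. \<bar>g n\<bar>) ` {n. g n \<noteq> 0})" by auto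
  then have "finite (range (\<lambda>n. \<bar>g n\<bar>))"
    using assms by (auto simp: finite_seqs_def intro: finite_subset)
  then show ?thesis unfolding sup_norm_def by (intro cSUP_upper bdd_above_finite) auto
qed

context pisot_power_sum
begin

lemma greedy_unique:
  assumes "represents U d n" "greedy_bound U d" "represents U e n" "greedy_bound U e"
  shows "d = e"
proof -
  have "normalised U n = d" "normalised U n = e"
    using normalised_eq_iff[of U n, OF U_0 U_pos finite_U_le] assms by blast+
  then show ?thesis by simp
qed

text \<open>
  The shifted \<open>\<beta>\<close>-expansion of \<open>Q(\<beta>)\<close> is itself \<open>U\<close>-greedy once the shift is so large that the finitely
  many inequalities between digit sums hold for \<open>U\<close>, and that \<open>U\<close> increases from there on. Uniqueness
  of the greedy expansion then shows that no non-zero digit lies more than \<open>L\<close> places below \<open>k\<close>.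
\<close>
lemma greedy_of_nonneg_element:
  assumes F: "condition_F \<beta>" and z: "int_eval Q \<beta> \<ge> 0"
  shows "\<exists>K. \<forall>k\<ge>K. \<forall>e n. represents U e n \<longrightarrow> greedy_bound U e \<longrightarrow> int n = window_sum U k Q \<longrightarrow>
           (\<forall>i. i + K < k \<longrightarrow> e i = 0)"
proof -
  have "int_eval Q \<beta> \<in> Fin \<beta>" using F z unfolding condition_F_def int_adjoin_def by blast
  then obtain d where d: "is_beta_expansion \<beta> (int_eval Q \<beta>) d" "finite {i. d i \<noteq> 0}"
    unfolding Fin_def by blast
  obtain L J D where D: "\<forall>j>J. D j = 0"
    and total: "(\<Sum>j\<le>J. real (D j) * \<beta> ^ j) = \<beta> ^ L * int_eval Q \<beta>"
    and greedy: "\<And>l. l \<le> J \<Longrightarrow> (\<Sum>j\<le>l. real (D j) * \<beta> ^ j) < \<beta> ^ Suc l"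
    using finite_beta_expansion[OF d beta_gt_1] by metis
  have ev: "\<forall>\<^sub>F h in sequentially. (\<Sum>j\<le>l. int (D j) * U (h + j)) < U (h + Suc l)" if "l \<le> J" for l
  proof -
    have "\<forall>\<^sub>F h in sequentially.
        window_sum U h (monom 1 (Suc l) - poly_upto (\<lambda>j. int (D j)) l) > 0"
      using greedy[OF that] by (intro eventually_window_sum_pos)
        (simp add: int_eval_diff int_eval_monom int_eval_poly_upto)
    then show ?thesis by (simp add: window_sum_diff window_sum_monom window_sum_poly_upto)
  qed
  have "\<forall>\<^sub>F h in sequentially. \<forall>l\<in>{..J}. (\<Sum>j\<le>l. int (D j) * U (h + j)) < U (h + Suc l)"
    using ev by (intro eventually_ball_finite) auto
  then obtain h1 where h1: "\<And>h l. h \<ge> h1 \<Longrightarrow> l \<le> J \<Longrightarrow>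
      (\<Sum>j\<le>l. int (D j) * U (h + j)) < U (h + Suc l)"
    unfolding eventually_sequentially by (metis atMost_iff)
  obtain h2 where h2: "\<And>h. h \<ge> h2 \<Longrightarrow> U h < U (Suc h)"
    using eventually_U_increasing unfolding eventually_sequentially by blast
  have mono: "U a \<le> U b" if "h2 \<le> a" "a \<le> b" for a b
    using that(2)
  proof (induction rule: dec_induct)
    case (step m)
    then show ?case using h2[of m] that(1) by linarith
  qed simp
  \<comment> \<open>\<open>h1\<close> secures the greedy inequalities up to the leading digit, \<open>h2\<close> those beyond it.\<close>
  define h0 where "h0 = max h1 h2"
  have "e i = 0" if k: "k \<ge> L + h0" and e: "represents U e n" "greedy_bound U e"
    and n: "int n = window_sum U k Q" and i: "i + (L + h0) < k" for k e n i
  proof -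
    define h where "h = k - L"
    have h: "k = h + L" "h \<ge> h0" using k by (auto simp: h_def)
    define E where "E i = (if h \<le> i then D (i - h) else 0)" for i
    have shift: "(\<Sum>i\<le>h + l. int (E i) * U i) = (\<Sum>j\<le>l. int (D j) * U (h + j))" for l
    proof -
      have "(\<Sum>i\<le>h + l. int (E i) * U i) = (\<Sum>i\<in>{h..h + l}. int (E i) * U i)"
        by (rule sum.mono_neutral_right) (auto simp: E_def)
      also have "\<dots> = (\<Sum>j\<le>l. int (D j) * U (h + j))"
        by (rule sum.reindex_bij_witness[of _ "\<lambda>j. h + j" "\<lambda>i. i - h"]) (auto simp: E_def)
      finally show ?thesis .
    qed
    have "window_sum U k Q = window_sum U h (poly_upto (\<lambda>j. int (D j)) J)"
      unfolding h(1) by (rule window_sum_cong) (simp add: int_eval_poly_upto total)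
    then have "(\<Sum>i\<le>h + J. int (E i) * U i) = int n"
      by (simp add: shift window_sum_poly_upto n)
    moreover have "\<forall>i>h + J. E i = 0" using D by (auto simp: E_def)
    ultimately have "represents U E n" using represents_iff by blast
    moreover have "greedy_bound U E"
      unfolding greedy_bound_def
    proof
      fix l
      consider "l < h" | j where "l = h + j" "j \<le> J" | j where "l = h + j" "j > J"
        by (metis le_add_diff_inverse not_less)
      then show "(\<Sum>i\<le>l. int (E i) * U i) < U (Suc l)"
      proof cases
        case 1
        then have "(\<Sum>i\<le>l. int (E i) * U i) = 0" by (intro sum.neutral) (auto simp: E_def)
        then show ?thesis using U_pos by simp
      next
        case 2
        then show ?thesis using h1[of h j] h by (simp add: shift h0_def)
      next
        case 3
        have "(\<Sum>i\<le>l. int (E i) * U i) = (\<Sum>i\<le>J. int (D i) * U (h + i))"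
          unfolding 3 shift using 3 D by (intro sum.mono_neutral_right) auto
        also have "\<dots> < U (h + Suc J)" using h1[of h J] h by (simp add: h0_def)
        also have "\<dots> \<le> U (Suc l)" using 3 h by (intro mono) (auto simp: h0_def)
        finally show ?thesis .
      qed
    qed
    ultimately have "e = E" using e greedy_unique by blast
    then show ?thesis using i by (simp add: E_def h_def)
  qed
  then show ?thesis by blast
qed

text \<open>
  A negative element has negative values at high places, so it represents no natural number there.
\<close>
lemma greedy_of_element:
  assumes F: "condition_F \<beta>"
  shows "\<exists>K. \<forall>k\<ge>K. \<forall>e n. represents U e n \<longrightarrow> greedy_bound U e \<longrightarrow> int n = window_sum U k Q \<longrightarrow>
           (\<forall>i. i + K < k \<longrightarrow> e i = 0)"
proof (cases "int_eval Q \<beta> \<ge> 0")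
  case True
  then show ?thesis by (rule greedy_of_nonneg_element[OF F])
next
  case False
  then have "\<forall>\<^sub>F k in sequentially. window_sum U k (- Q) > 0"
    by (intro eventually_window_sum_pos) (simp add: int_eval_minus)
  then obtain K where K: "\<And>k. k \<ge> K \<Longrightarrow> window_sum U k Q < 0"
    unfolding eventually_sequentially by (auto simp: window_sum_minus)
  then have "int n \<noteq> window_sum U k Q" if "k \<ge> K" for k n using that by force
  then show ?thesis by metis
qed

section \<open>Preservation of zeros\<close>

text \<open>
  Only the conjugates other than \<open>\<beta>\<close> are assumed bounded. For \<open>\<beta>\<close> itself the bound comes from the
  power sum: \<open>C\<^sub>\<beta> \<beta>\<^sup>k Q(\<beta>)\<close> differs from the value by at most \<open>\<Sum>\<^sub>\<alpha> |C\<^sub>\<alpha>| M\<^sub>\<alpha>\<close>, and the value is at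
  most \<open>u\<^sub>k = O(\<beta>\<^sup>k)\<close>.
\<close>
lemma finite_window_values:
  assumes M: "\<And>\<alpha>. \<alpha> \<in> A \<Longrightarrow> \<alpha> \<noteq> of_real \<beta> \<Longrightarrow> M \<alpha> \<ge> 0"
  shows "finite {int_eval Q \<beta> | Q k. (\<forall>\<alpha>\<in>A - {of_real \<beta>}. norm (int_eval Q \<alpha>) \<le> M \<alpha>) \<and>
           \<bar>window_sum U k Q\<bar> \<le> U k}"
proof -
  obtain \<gamma> where \<gamma>: "\<gamma> > 0" "C \<beta> = of_real \<gamma>" by (rule C_beta_pos)
  obtain T where T: "T \<ge> 0" "\<And>n. of_int (U n) \<le> T * \<beta> ^ n" using U_le_power by blast
  define S where "S = (\<Sum>\<alpha>\<in>A - {of_real \<beta>}. norm (C \<alpha>) * M \<alpha>)"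
  have S: "S \<ge> 0" unfolding S_def using M by (intro sum_nonneg mult_nonneg_nonneg) auto
  define N where "N = (T + S) / \<gamma> + (\<Sum>\<alpha>\<in>A - {of_real \<beta>}. M \<alpha>)"
  have "norm (int_eval Q \<alpha>) \<le> N"
    if Q: "\<forall>\<alpha>\<in>A - {of_real \<beta>}. norm (int_eval Q \<alpha>) \<le> M \<alpha>"
      and k: "\<bar>window_sum U k Q\<bar> \<le> U k" and \<alpha>: "\<alpha> \<in> A" for Q k \<alpha>
  proof (cases "\<alpha> = of_real \<beta>")
    case False
    have "norm (int_eval Q \<alpha>) \<le> M \<alpha>" using Q \<alpha> False by simp
    also have "\<dots> \<le> (\<Sum>\<alpha>\<in>A - {of_real \<beta>}. M \<alpha>)"
      using \<alpha> False M finite_A by (intro member_le_sum) auto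
    also have "\<dots> \<le> N" unfolding N_def using T S \<gamma> by simp
    finally show ?thesis .
  next
    case True
    let ?rest = "\<Sum>\<alpha>\<in>A - {of_real \<beta>}. C \<alpha> * \<alpha> ^ k * int_eval Q \<alpha>"
    have "of_real (\<gamma> * \<beta> ^ k * int_eval Q \<beta>) = of_int (window_sum U k Q) - ?rest"
      unfolding window_sum_power_sum sum_A by (simp add: \<gamma> int_eval_of_real)
    then have "norm (of_real (\<gamma> * \<beta> ^ k * int_eval Q \<beta>) :: complex)
        \<le> norm (of_int (window_sum U k Q) :: complex) + norm ?rest"
      by (metis norm_triangle_ineq4)
    moreover have "norm (of_int (window_sum U k Q) :: complex) \<le> T * \<beta> ^ k"
    proof -
      have "norm (of_int (window_sum U k Q) :: complex) = of_int \<bar>window_sum U k Q\<bar>" by simp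
      also have "\<dots> \<le> of_int (U k)" using k by (simp only: of_int_le_iff)
      finally show ?thesis using T(2)[of k] by linarith
    qed
    moreover have "norm ?rest \<le> S"
      unfolding S_def
    proof (rule sum_norm_le)
      fix \<alpha> assume \<alpha>: "\<alpha> \<in> A - {of_real \<beta>}"
      then have "norm \<alpha> ^ k \<le> 1" using conjugate_lt_1[of \<alpha>] by (intro power_le_one) auto
      then have "norm (C \<alpha>) * norm \<alpha> ^ k \<le> norm (C \<alpha>) * 1" by (intro mult_left_mono) auto
      then show "norm (C \<alpha> * \<alpha> ^ k * int_eval Q \<alpha>) \<le> norm (C \<alpha>) * M \<alpha>"
        using Q \<alpha> by (auto simp: norm_mult norm_power intro!: mult_mono)
    qed
    moreover have "S \<le> S * \<beta> ^ k" using S beta_gt_1 mult_left_mono[of 1 "\<beta> ^ k" S] by simp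
    ultimately have "\<gamma> * \<beta> ^ k * \<bar>int_eval Q \<beta>\<bar> \<le> (T + S) * \<beta> ^ k"
      using \<gamma> beta_gt_1 by (simp only: norm_of_real) (simp add: abs_mult distrib_right)
    then have "\<gamma> * \<bar>int_eval Q \<beta>\<bar> * \<beta> ^ k \<le> (T + S) * \<beta> ^ k" by (simp add: mult_ac)
    then have "\<gamma> * \<bar>int_eval Q \<beta>\<bar> \<le> T + S"
      by (rule mult_right_le_imp_le) (use beta_gt_1 in simp)
    then have "\<bar>int_eval Q \<beta>\<bar> \<le> (T + S) / \<gamma>" using \<gamma> by (simp add: pos_le_divide_eq mult.commute)
    also have "\<dots> \<le> N" unfolding N_def using M by (auto intro: sum_nonneg)
    finally show ?thesis by (simp add: True int_eval_of_real)
  qed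
  then have "{int_eval Q \<beta> | Q k. (\<forall>\<alpha>\<in>A - {of_real \<beta>}. norm (int_eval Q \<alpha>) \<le> M \<alpha>) \<and>
           \<bar>window_sum U k Q\<bar> \<le> U k} \<subseteq> {int_eval Q \<beta> | Q. \<forall>\<alpha>\<in>A. norm (int_eval Q \<alpha>) \<le> N}"
    by blast
  moreover have "finite {int_eval Q \<beta> | Q. \<forall>\<alpha>\<in>A. norm (int_eval Q \<alpha>) \<le> N}"
    by (rule finite_values_bounded_conjugates[OF min_poly])
  ultimately show ?thesis by (rule finite_subset)
qed

text \<open>
  Removing from \<open>g\<close> the digits of \<open>e\<close> at places \<open>\<ge> m\<close> leaves the number represented by the low part of
  \<open>e\<close>, and \<open>finite_window_values\<close> confines the corresponding element of \<open>\<int>[\<beta>]\<close> to a finite set that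
  depends on \<open>c\<close> only. The thresholds of its elements are combined into one constant.
\<close>
lemma greedy_vanishes_below:
  assumes F: "condition_F \<beta>"
  shows "\<exists>K. \<forall>g\<in>finite_seqs. \<forall>m e n. (\<forall>i. \<bar>g i\<bar> \<le> int c) \<longrightarrow> (\<forall>i<m. g i = 0) \<longrightarrow>
    seq_val U g = int n \<longrightarrow> represents U e n \<longrightarrow> greedy_bound U e \<longrightarrow> (\<forall>i. i + K < m \<longrightarrow> e i = 0)"
proof -
  obtain B where B: "B \<ge> 0" "\<And>e i. greedy_bound U e \<Longrightarrow> int (e i) \<le> B"
    using greedy_digits_bounded by blast
  \<comment> \<open>The geometric series bounds a polynomial with coefficients at most \<open>c + B\<close> at \<open>\<alpha>\<close>.\<close>
  define M where "M \<alpha> = real_of_int (int c + B) / (1 - norm \<alpha>)" for \<alpha> :: complex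
  have M: "M \<alpha> \<ge> 0" if "\<alpha> \<in> A" "\<alpha> \<noteq> of_real \<beta>" for \<alpha>
    using B(1) conjugate_lt_1[OF that] by (simp add: M_def)
  define Z where "Z = {int_eval Q \<beta> | Q k. (\<forall>\<alpha>\<in>A - {of_real \<beta>}. norm (int_eval Q \<alpha>) \<le> M \<alpha>) \<and>
           \<bar>window_sum U k Q\<bar> \<le> U k}"
  have Z: "finite Z" unfolding Z_def by (rule finite_window_values[OF M])
  have "\<exists>K. \<forall>Q k e n. int_eval Q \<beta> = z \<longrightarrow> k \<ge> K \<longrightarrow> represents U e n \<longrightarrow> greedy_bound U e \<longrightarrow>
      int n = window_sum U k Q \<longrightarrow> (\<forall>i. i + K < k \<longrightarrow> e i = 0)" if z: "z \<in> Z" for z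
  proof -
    obtain Q0 where Q0: "int_eval Q0 \<beta> = z" using z unfolding Z_def by blast
    have same: "window_sum U k Q = window_sum U k Q0" if "int_eval Q \<beta> = z" for Q k
      using window_sum_cong[of 0 Q Q0 k] that Q0 by simp
    obtain K where "\<forall>k\<ge>K. \<forall>e n. represents U e n \<longrightarrow> greedy_bound U e \<longrightarrow>
        int n = window_sum U k Q0 \<longrightarrow> (\<forall>i. i + K < k \<longrightarrow> e i = 0)"
      using greedy_of_element[OF F, of Q0] by blast
    then show ?thesis by (intro exI[of _ K]) (simp add: same)
  qed
  then obtain Kz where Kz: "\<And>z Q k e n. z \<in> Z \<Longrightarrow> int_eval Q \<beta> = z \<Longrightarrow> k \<ge> Kz z \<Longrightarrow>
      represents U e n \<Longrightarrow> greedy_bound U e \<Longrightarrow> int n = window_sum U k Q \<Longrightarrow>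
      (\<forall>i. i + Kz z < k \<longrightarrow> e i = 0)"
    by metis
  define K where "K = (\<Sum>z\<in>Z. Kz z)"
  have K: "Kz z \<le> K" if "z \<in> Z" for z
    unfolding K_def using that Z by (intro member_le_sum) auto
  show ?thesis
  proof (intro exI[of _ K] ballI allI impI)
    fix g m e n i
    assume g: "g \<in> finite_seqs" "\<forall>i. \<bar>g i\<bar> \<le> int c" "\<forall>i<m. g i = 0" "seq_val U g = int n"
      and e: "represents U e n" "greedy_bound U e" and i: "i + K < m"
    obtain N1 N2 where N12: "\<forall>i>N1. g i = 0" "\<forall>i>N2. e i = 0"
      using g(1) e(1) by (auto simp: represents_def finite_seqs_iff)
    define N where "N = max N1 N2"
    \<comment> \<open>The low part of a greedy expansion is the greedy expansion of the number it represents.\<close>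
    define e' where "e' i = (if i < m then e i else 0)" for i
    define n' where "n' = nat (\<Sum>i<m. int (e i) * U i)"
    have n': "int n' = (\<Sum>i<m. int (e i) * U i)"
      unfolding n'_def by (simp add: sum_nonneg U_pos less_imp_le)
    define Q where "Q = poly_upto (\<lambda>i. g (m + i) - int (e (m + i))) N"
    have rep: "represents U e' n'"
    proof -
      have "(\<Sum>i\<le>m. int (e' i) * U i) = (\<Sum>i<m. int (e i) * U i)"
        by (simp add: lessThan_Suc_atMost[symmetric] e'_def)
      moreover have "\<forall>i>m. e' i = 0" by (simp add: e'_def)
      ultimately show ?thesis using n' represents_iff by metis
    qed
    have bound: "greedy_bound U e'"
      unfolding greedy_bound_def
    proof
      fix l
      have "(\<Sum>i\<le>l. int (e' i) * U i) \<le> (\<Sum>i\<le>l. int (e i) * U i)"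
        by (intro sum_mono) (simp add: e'_def U_pos less_imp_le)
      also have "\<dots> < U (Suc l)" using e(2) by (simp add: greedy_bound_def)
      finally show "(\<Sum>i\<le>l. int (e' i) * U i) < U (Suc l)" .
    qed
    have win: "window_sum U m Q = int n'"
    proof -
      have split: "(\<Sum>i\<le>m + N. f i) = (\<Sum>i<m. f i) + (\<Sum>i\<le>N. f (m + i))" for f :: "nat \<Rightarrow> int"
        by (induction N) (simp_all add: lessThan_Suc_atMost[symmetric])
      have "\<forall>i>m + N. g i = 0" "\<forall>i>m + N. e i = 0" using N12 by (auto simp: N_def)
      then have "(\<Sum>i\<le>m + N. g i * U i) = (\<Sum>i\<le>m + N. int (e i) * U i)"
        using g(4) e(1) seq_val_eq_sum[of "m + N" g U] represents_iff[of "m + N" e U n] by simp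
      moreover have "(\<Sum>i<m. g i * U i) = 0" using g(3) by simp
      ultimately have "(\<Sum>i\<le>N. g (m + i) * U (m + i))
          = (\<Sum>i<m. int (e i) * U i) + (\<Sum>i\<le>N. int (e (m + i)) * U (m + i))"
        by (simp add: split)
      then show ?thesis
        by (simp add: n' Q_def window_sum_poly_upto left_diff_distrib sum_subtractf)
    qed
    have "int n' \<le> U m"
    proof (cases m)
      case 0
      then show ?thesis using n' U_pos[of 0] by simp
    next
      case (Suc l)
      have "(\<Sum>i\<le>l. int (e i) * U i) < U (Suc l)" using e(2) unfolding greedy_bound_def by blast
      then show ?thesis using n' Suc by (simp add: lessThan_Suc_atMost)
    qed
    then have "\<bar>window_sum U m Q\<bar> \<le> U m" using win by simp
    moreover have "\<forall>\<alpha>\<in>A - {of_real \<beta>}. norm (int_eval Q \<alpha>) \<le> M \<alpha>"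
    proof
      fix \<alpha> assume "\<alpha> \<in> A - {of_real \<beta>}"
      then have \<alpha>: "norm \<alpha> < 1" using conjugate_lt_1 by auto
      have "norm (int_eval Q \<alpha>) \<le> (\<Sum>i\<le>N. of_int (int c + B) * norm \<alpha> ^ i)"
        unfolding Q_def int_eval_poly_upto
      proof (rule sum_norm_le)
        fix i
        have "\<bar>g (m + i) - int (e (m + i))\<bar> \<le> int c + B"
          using g(2)[rule_format, of "m + i"] B(2)[OF e(2), of "m + i"] by linarith
        then have "\<bar>real_of_int (g (m + i) - int (e (m + i)))\<bar> \<le> of_int (int c + B)"
          by (simp only: of_int_abs[symmetric] of_int_le_iff)
        then show "norm (of_int (g (m + i) - int (e (m + i))) * \<alpha> ^ i) \<le> of_int (int c + B) * norm \<alpha> ^ i"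
          by (simp only: norm_mult norm_power norm_of_int) (intro mult_right_mono, auto)
      qed
      also have "\<dots> = of_int (int c + B) * (\<Sum>i\<le>N. norm \<alpha> ^ i)" by (simp add: sum_distrib_left)
      also have "\<dots> \<le> of_int (int c + B) * (1 / (1 - norm \<alpha>))"
      proof (rule mult_left_mono)
        have "(\<Sum>i\<le>N. norm \<alpha> ^ i) = (1 - norm \<alpha> ^ Suc N) / (1 - norm \<alpha>)"
          unfolding lessThan_Suc_atMost[symmetric] using \<alpha> by (subst sum_gp_strict) auto
        also have "\<dots> \<le> 1 / (1 - norm \<alpha>)" using \<alpha> by (intro divide_right_mono) auto
        finally show "(\<Sum>i\<le>N. norm \<alpha> ^ i) \<le> 1 / (1 - norm \<alpha>)" .
      qed (use B(1) in simp)
      finally show "norm (int_eval Q \<alpha>) \<le> M \<alpha>" by (simp add: M_def)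
    qed
    ultimately have "int_eval Q \<beta> \<in> Z" unfolding Z_def by blast
    then have "e' i = 0"
      using Kz[OF _ refl _ rep bound, of Q m] win[symmetric] K[of "int_eval Q \<beta>"] i by auto
    then show "e i = 0" using i by (simp add: e'_def)
  qed
qed

lemma preserves_zeros_if_condition_F:
  assumes "condition_F \<beta>"
  shows "preserves_zeros U"
  unfolding preserves_zeros_def
proof
  fix c :: nat
  obtain K where K: "\<forall>g\<in>finite_seqs. \<forall>m e n. (\<forall>i. \<bar>g i\<bar> \<le> int c) \<longrightarrow> (\<forall>i<m. g i = 0) \<longrightarrow>
    seq_val U g = int n \<longrightarrow> represents U e n \<longrightarrow> greedy_bound U e \<longrightarrow> (\<forall>i. i + K < m \<longrightarrow> e i = 0)"
    using greedy_vanishes_below[OF assms] by blast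
  have "seq_ord g \<le> nu U (seq_val U g) + enat K"
    if g: "g \<in> finite_seqs" "sup_norm g \<le> int c" for g
  proof -
    define n where "n = nat \<bar>seq_val U g\<bar>"
    define e where "e = normalised U n"
    have e: "represents U e n" "greedy_bound U e"
      using normalised_eq_iff[of U n e, OF U_0 U_pos finite_U_le] by (auto simp: e_def)
    have bound: "\<bar>g i\<bar> \<le> int c" for i using abs_le_sup_norm[OF g(1), of i] g(2) by linarith
    have neg: "(\<lambda>i. - g i) \<in> finite_seqs" using g(1) by (simp add: finite_seqs_def)
    have zero: "e i = 0" if m: "\<And>i. i < m \<Longrightarrow> g i = 0" and i: "i + K < m" for m i
    proof (cases "seq_val U g \<ge> 0")
      case True
      then show ?thesis using K[rule_format, OF g(1), of m n e i] bound m e i by (simp add: n_def)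
    next
      case False
      then show ?thesis using K[rule_format, OF neg, of m n e i] bound m e i
        by (simp add: n_def seq_val_uminus)
    qed
    have "seq_ord g \<le> enat i + enat K" if "e i \<noteq> 0" for i
    proof (rule ccontr)
      assume "\<not> seq_ord g \<le> enat i + enat K"
      then have *: "enat (i + K) < seq_ord g" by simp
      have "g j = 0" if "j < Suc (i + K)" for j
      proof (rule ccontr)
        assume "g j \<noteq> 0"
        then have "seq_ord g \<le> enat j" unfolding seq_ord_def by (intro INF_lower) simp
        also have "\<dots> \<le> enat (i + K)" using that by simp
        finally show False using * by simp
      qed
      then show False using zero[of "Suc (i + K)" i] that by simp
    qed
    note le = this
    show ?thesis
    proof (cases "\<exists>i. e i \<noteq> 0")
      case True
      then obtain i where "enat i \<in> enat ` {i. e i \<noteq> 0}" by blast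
      then have "(LEAST x. x \<in> enat ` {i. e i \<noteq> 0}) \<in> enat ` {i. e i \<noteq> 0}" by (rule LeastI)
      then have "seq_ord e \<in> enat ` {i. e i \<noteq> 0}"
        using True by (simp add: seq_ord_def Inf_enat_def)
      then show ?thesis using le by (auto simp: nu_def n_def[symmetric] e_def[symmetric])
    next
      case False
      then have "nu U (seq_val U g) = \<infinity>"
        by (simp add: nu_def n_def[symmetric] e_def[symmetric] seq_ord_def top_enat_def)
      then show ?thesis by simp
    qed
  qed
  then show "\<exists>K. \<forall>g\<in>finite_seqs. sup_norm g \<le> int c \<longrightarrow> seq_ord g \<le> nu U (seq_val U g) + enat K"
    by blast
qed

end

theorem proposition49:
  fixes \<beta> :: real and U :: "nat \<Rightarrow> int"
  assumes "pisot_number \<beta>"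
    and "pisot_numeration \<beta> U"
    and "condition_F \<beta>"
  shows "preserves_zeros U"
proof -
  obtain P v where P: "is_min_poly \<beta> P" and pos: "\<And>n. U n > 0" and v: "\<forall>n. U n = v (int n)" "v 0 = 1"
      "\<forall>n\<ge>1. v n = (\<Sum>i<degree P. - coeff P i * v (n - int (degree P) + int i))"
    using assms(2) unfolding pisot_numeration_def by blast
  obtain C where C: "\<And>n. of_int (v (int n)) = (\<Sum>\<alpha>\<in>complex_roots P. C \<alpha> * \<alpha> ^ n :: complex)"
    using pisot_numeration_power_sum[OF P v(2,3)] by blast
  interpret pisot_power_sum \<beta> P U C
  proof
    show "norm \<alpha> < 1" if "\<alpha> \<in> complex_roots P" "\<alpha> \<noteq> of_real \<beta>" for \<alpha>
    proof -
      have "\<alpha> \<in> galois_conjugates \<beta>" using P that(1) unfolding galois_conjugates_def complex_roots_def by blast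
      then show ?thesis using assms(1) that(2) unfolding pisot_number_def by blast
    qed
    show "U 0 = 1" using v(1)[rule_format, of 0] v(2) by simp
  qed (use P pos v C assms(1) in \<open>auto simp: pisot_number_def\<close>)
  show ?thesis by (rule preserves_zeros_if_condition_F[OF assms(3)])
qed

end
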